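(* Assume: (eigenvalue decay) $c\,i^{-\beta}\le\lambda_i\le C_0\,i^{-\beta}$ for all $i\ge1$ and some constants $c,C_0>0$; (Hölder continuity) for some $h\in(0,\frac12]$ and $L_k>0$, $|k(x_1,x_2)-k(x_1',x_2')|\le L_k|(x_1,x_2)-(x_1',x_2')|^{2h}$ for all $x_1,x_2,x_1',x_2'\in\mathcal X$; (embedding index) $\alpha_0=\frac1\beta$. Assume further that the marginal distribution $\mu$ is a Radon measure and that the noises $\xi_j=y_j-f^*(x_j)$ are independent Gaussian with $\xi_j|x_j\sim N(0,\sigma^2)$ for some $\sigma>0$. Let $s>\alpha_0$, $R>0$, and $$\mathcal B(R)=\{f\in[\mathcal H]^s:\ \|f\|_{[\mathcal H]^s}\le R\}.$$ Then for the sample size $n$, $$\inf_{\hat f}\ \sup_{f^*\in\mathcal B(R)}\mathrm E\big\|\hat f-f^*\big\|_\infty\ \ge\ C\,n^{-\frac{s\beta-1}{2s\beta}}$$ for some constant $C>0$ depending only on $\sigma,d,\beta,L_k,h,s,R$ and $L$, where the infimum is over all possible learning methods $\hat f$ (maps from the data $\{(x_i,y_i)\}_{i=1}^n$ to functions on $\mathcal X$).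
   Context: $\mathcal X\subset\mathbb R^d$ is compact with a probability measure $\mu$; the data $(x_j,y_j)$, $j=1,\dots,n$, are i.i.d. with $x_j\sim\mu$ and $y_j=f^*(x_j)+\xi_j$; $\mathrm E$ is expectation over the data generated with regression function $f^*$. $L^2(\mathcal X)=L^2(\mathcal X,\mu)$, $\|\cdot\|_\infty$ is the supremum norm on $\mathcal X$. $L$ denotes a constant for which the Gaussian noise satisfies $\mathrm E[|\xi|^m|x]\le\frac12m!\,\sigma^2L^{m-2}$ for all integers $m>2$. $k:\mathcal X\times\mathcal X\to\mathbb R$ is a symmetric positive kernel with $\sup_xk(x,x)\le\kappa^2$, and $\mathcal H$ is its reproducing kernel Hilbert space. $Tf(x)=\int_{\mathcal X}k(x,z)f(z)\,d\mu(z)$ has eigenvalues $\lambda_1\ge\lambda_2\ge\dots>0$ with continuous eigenfunctions $e_i$ forming an orthonormal basis of $L^2(\mathcal X)$, and $k(x,x')=\sum_i\lambda_ie_i(x)e_i(x')$ absolutely and uniformly. For $s\ge0$, $[\mathcal H]^s=\{\sum_if_i\lambda_i^{s/2}e_i:\{f_i\}\in\ell^2\}$ with $\|\sum_if_i\lambda_i^{s/2}e_i\|_{[\mathcal H]^s}^2=\sum_if_i^2$. $M_\alpha^2=\sup_{x}\sum_i\lambda_i^\alpha e_i(x)^2\in[0,\infty]$, and the embedding index is $\alpha_0=\inf\{\alpha\in[\frac1\beta,1]:M_\alpha<\infty\}$. If $M_\alpha<\infty$, elements of $[\mathcal H]^\alpha$ are identified with continuous functions.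
   Formalization: The constant C may also depend on the lower eigenvalue-decay constant c; without this the claim is false, since replacing k by tk with t→0 keeps all listed parameters but shrinks the sup-norms on B(R) to 0. *)

theory Defs
  imports "HOL-Probability.Probability"
begin

text \<open>
  Throughout, the compact set on which the covariates live is \<open>space \<mu>\<close>, and sequences are indexed
  from \<open>0\<close>: \<open>lam i\<close> and \<open>e i\<close> are the eigenvalue and the eigenfunction of number \<open>i + 1\<close>.
  Functions on \<open>space \<mu>\<close> are total functions whose values elsewhere never matter.
\<close>

definition radon_measure :: "'a::metric_space measure \<Rightarrow> bool" where
  "radon_measure \<mu> \<longleftrightarrow>
     sets \<mu> = sets (restrict_space borel (space \<mu>)) \<and>
     (\<forall>K. compact K \<and> K \<subseteq> space \<mu> \<longrightarrow> emeasure \<mu> K < \<infinity>) \<and>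
     (\<forall>A\<in>sets \<mu>. emeasure \<mu> A =
        (INF U\<in>{U. openin (top_of_set (space \<mu>)) U \<and> A \<subseteq> U}. emeasure \<mu> U)) \<and>
     (\<forall>U. openin (top_of_set (space \<mu>)) U \<longrightarrow> emeasure \<mu> U =
        (SUP K\<in>{K. compact K \<and> K \<subseteq> U}. emeasure \<mu> K))"

definition integral_operator :: "'a measure \<Rightarrow> ('a \<Rightarrow> 'a \<Rightarrow> real) \<Rightarrow> ('a \<Rightarrow> real) \<Rightarrow> 'a \<Rightarrow> real" where
  "integral_operator \<mu> k f x = (LINT z|\<mu>. k x z * f z)"

definition L2_inner :: "'a measure \<Rightarrow> ('a \<Rightarrow> real) \<Rightarrow> ('a \<Rightarrow> real) \<Rightarrow> real" where
  "L2_inner \<mu> f g = (LINT x|\<mu>. f x * g x)"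

definition square_integrable :: "'a measure \<Rightarrow> ('a \<Rightarrow> real) \<Rightarrow> bool" where
  "square_integrable \<mu> f \<longleftrightarrow> f \<in> borel_measurable \<mu> \<and> integrable \<mu> (\<lambda>x. (f x)\<^sup>2)"

text \<open>Convergence of a series of square-integrable functions in mean square.\<close>

definition L2_sums :: "'a measure \<Rightarrow> (nat \<Rightarrow> 'a \<Rightarrow> real) \<Rightarrow> ('a \<Rightarrow> real) \<Rightarrow> bool" where
  "L2_sums \<mu> u g \<longleftrightarrow> square_integrable \<mu> g \<and>
     (\<lambda>N. LINT x|\<mu>. (g x - (\<Sum>i<N. u i x))\<^sup>2) \<longlonglongrightarrow> 0"

definition orthonormal_basis_L2 :: "'a measure \<Rightarrow> (nat \<Rightarrow> 'a \<Rightarrow> real) \<Rightarrow> bool" where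
  "orthonormal_basis_L2 \<mu> e \<longleftrightarrow>
     (\<forall>i. square_integrable \<mu> (e i)) \<and>
     (\<forall>i j. L2_inner \<mu> (e i) (e j) = (if i = j then 1 else 0)) \<and>
     (\<forall>f. square_integrable \<mu> f \<longrightarrow> L2_sums \<mu> (\<lambda>i x. L2_inner \<mu> f (e i) * e i x) f)"

definition positive_kernel :: "'a set \<Rightarrow> ('a \<Rightarrow> 'a \<Rightarrow> real) \<Rightarrow> bool" where
  "positive_kernel X k \<longleftrightarrow>
     (\<forall>x\<in>X. \<forall>y\<in>X. k x y = k y x) \<and>
     (\<forall>F a. finite F \<and> F \<subseteq> X \<longrightarrow> (\<Sum>x\<in>F. \<Sum>y\<in>F. a x * a y * k x y) \<ge> 0)"

locale mercer_kernel = prob_space \<mu>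
  for \<mu> :: "(real ^ 'd) measure" +
  fixes k :: "real ^ 'd \<Rightarrow> real ^ 'd \<Rightarrow> real" and \<kappa> :: real
    and lam :: "nat \<Rightarrow> real" and e :: "nat \<Rightarrow> real ^ 'd \<Rightarrow> real"
  assumes compact_space: "compact (space \<mu>)"
    and sets_eq_borel: "sets \<mu> = sets (restrict_space borel (space \<mu>))"
    and kernel: "positive_kernel (space \<mu>) k"
    and kernel_bound: "\<And>x. x \<in> space \<mu> \<Longrightarrow> k x x \<le> \<kappa>\<^sup>2"
    and lam_decseq: "decseq lam"
    and lam_pos: "\<And>i. lam i > 0"
    and eigenfunction: "\<And>i x. x \<in> space \<mu> \<Longrightarrow> integral_operator \<mu> k (e i) x = lam i * e i x"
    and eigenfunction_continuous: "\<And>i. continuous_on (space \<mu>) (e i)"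
    and eigenfunction_basis: "orthonormal_basis_L2 \<mu> e"
    and mercer_absolute: "\<And>x y. x \<in> space \<mu> \<Longrightarrow> y \<in> space \<mu> \<Longrightarrow>
          summable (\<lambda>i. \<bar>lam i * e i x * e i y\<bar>)"
    and mercer_uniform: "uniform_limit (space \<mu> \<times> space \<mu>)
          (\<lambda>N (x, y). \<Sum>i<N. lam i * e i x * e i y) (\<lambda>(x, y). k x y) sequentially"

definition eigenvalue_decay :: "(nat \<Rightarrow> real) \<Rightarrow> real \<Rightarrow> real \<Rightarrow> real \<Rightarrow> bool" where
  "eigenvalue_decay lam \<beta> c C0 \<longleftrightarrow>
     (\<forall>i. c * real (Suc i) powr (- \<beta>) \<le> lam i \<and> lam i \<le> C0 * real (Suc i) powr (- \<beta>))"

text \<open>The norm of a product type is the Euclidean norm of the pair.\<close>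

definition holder_kernel :: "'a::real_normed_vector set \<Rightarrow> ('a \<Rightarrow> 'a \<Rightarrow> real) \<Rightarrow> real \<Rightarrow> real \<Rightarrow> bool" where
  "holder_kernel X k Lk h \<longleftrightarrow>
     (\<forall>x1\<in>X. \<forall>x2\<in>X. \<forall>x1'\<in>X. \<forall>x2'\<in>X.
        \<bar>k x1 x2 - k x1' x2'\<bar> \<le> Lk * norm ((x1, x2) - (x1', x2')) powr (2 * h))"

definition embedding_const_sq ::
    "'a measure \<Rightarrow> (nat \<Rightarrow> real) \<Rightarrow> (nat \<Rightarrow> 'a \<Rightarrow> real) \<Rightarrow> real \<Rightarrow> ennreal" where
  "embedding_const_sq \<mu> lam e \<alpha> =
     (SUP x\<in>space \<mu>. \<Sum>i. ennreal (lam i powr \<alpha> * (e i x)\<^sup>2))"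

text \<open>
  For a Mercer kernel with eigenvalue decay of order \<open>\<beta>\<close> the set below contains \<open>1\<close>,
  so the infimum is a genuine one.
\<close>

definition embedding_index ::
    "'a measure \<Rightarrow> (nat \<Rightarrow> real) \<Rightarrow> (nat \<Rightarrow> 'a \<Rightarrow> real) \<Rightarrow> real \<Rightarrow> real" where
  "embedding_index \<mu> lam e \<beta> =
     Inf {\<alpha>. 1 / \<beta> \<le> \<alpha> \<and> \<alpha> \<le> 1 \<and> embedding_const_sq \<mu> lam e \<alpha> < \<infinity>}"

text \<open>
  The interpolation spaces: \<open>g\<close> is a version of \<open>\<Sum>i. a i * lam i powr (s / 2) * e i\<close>, where
  \<open>a\<close> is square summable. Orthonormality makes \<open>a\<close> unique, hence the norm well defined.
\<close>

definition power_expansion ::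
    "'a measure \<Rightarrow> (nat \<Rightarrow> real) \<Rightarrow> (nat \<Rightarrow> 'a \<Rightarrow> real) \<Rightarrow> real \<Rightarrow> (nat \<Rightarrow> real) \<Rightarrow> ('a \<Rightarrow> real) \<Rightarrow> bool"
  where
  "power_expansion \<mu> lam e s a g \<longleftrightarrow>
     summable (\<lambda>i. (a i)\<^sup>2) \<and> L2_sums \<mu> (\<lambda>i x. a i * lam i powr (s / 2) * e i x) g"

definition power_space ::
    "'a measure \<Rightarrow> (nat \<Rightarrow> real) \<Rightarrow> (nat \<Rightarrow> 'a \<Rightarrow> real) \<Rightarrow> real \<Rightarrow> ('a \<Rightarrow> real) set" where
  "power_space \<mu> lam e s = {g. \<exists>a. power_expansion \<mu> lam e s a g}"

definition power_norm ::
    "'a measure \<Rightarrow> (nat \<Rightarrow> real) \<Rightarrow> (nat \<Rightarrow> 'a \<Rightarrow> real) \<Rightarrow> real \<Rightarrow> ('a \<Rightarrow> real) \<Rightarrow> real" where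
  "power_norm \<mu> lam e s g =
     (THE r. \<exists>a. power_expansion \<mu> lam e s a g \<and> r = sqrt (\<Sum>i. (a i)\<^sup>2))"

text \<open>
  Elements of the power space are classes modulo null sets. When the embedding constant of order
  \<open>s\<close> is finite, the series of such a class converges uniformly, and the class is identified with
  the continuous sum. The condition below selects exactly that version. Asking only for continuity
  would not, since \<open>\<mu>\<close> need not have full support.
\<close>

definition continuous_version ::
    "'a measure \<Rightarrow> (nat \<Rightarrow> 'a \<Rightarrow> real) \<Rightarrow> ('a \<Rightarrow> real) \<Rightarrow> bool" where
  "continuous_version \<mu> e g \<longleftrightarrow>
     (\<forall>x\<in>space \<mu>. (\<lambda>i. L2_inner \<mu> g (e i) * e i x) sums g x)"

definition power_ball ::
    "'a measure \<Rightarrow> (nat \<Rightarrow> real) \<Rightarrow> (nat \<Rightarrow> 'a \<Rightarrow> real) \<Rightarrow> real \<Rightarrow> real \<Rightarrow> ('a \<Rightarrow> real) set" where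
  "power_ball \<mu> lam e s R =
     {g \<in> power_space \<mu> lam e s. continuous_version \<mu> e g \<and> power_norm \<mu> lam e s g \<le> R}"

definition gaussian :: "real \<Rightarrow> real measure" where
  "gaussian \<sigma> = density lborel (\<lambda>t. ennreal (normal_density 0 \<sigma> t))"

definition noise_moment_bound :: "real \<Rightarrow> real \<Rightarrow> bool" where
  "noise_moment_bound \<sigma> L \<longleftrightarrow>
     (\<forall>m::nat. m > 2 \<longrightarrow> (LINT t|gaussian \<sigma>. \<bar>t\<bar> ^ m) \<le> 1 / 2 * fact m * \<sigma>\<^sup>2 * L ^ (m - 2))"

text \<open>Law of one observation \<open>(x, f x + \<xi>)\<close>, where \<open>\<xi>\<close> is Gaussian given \<open>x\<close>, and of \<open>n\<close> of them.\<close>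

definition observation :: "'a measure \<Rightarrow> real \<Rightarrow> ('a \<Rightarrow> real) \<Rightarrow> ('a \<times> real) measure" where
  "observation \<mu> \<sigma> f =
     distr (\<mu> \<Otimes>\<^sub>M gaussian \<sigma>) (\<mu> \<Otimes>\<^sub>M borel) (\<lambda>(x, \<xi>). (x, f x + \<xi>))"

definition sample :: "'a measure \<Rightarrow> real \<Rightarrow> nat \<Rightarrow> ('a \<Rightarrow> real) \<Rightarrow> (nat \<Rightarrow> 'a \<times> real) measure" where
  "sample \<mu> \<sigma> n f = Pi\<^sub>M {..<n} (\<lambda>_. observation \<mu> \<sigma> f)"

definition sup_norm :: "'a set \<Rightarrow> ('a \<Rightarrow> real) \<Rightarrow> ennreal" where
  "sup_norm X g = (SUP x\<in>X. ennreal \<bar>g x\<bar>)"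

text \<open>
  The outer expectation is the expectation for measurable integrands. It gives the risk a meaning
  for arbitrary learning methods: the supremum norm of an estimation error need not be measurable
  in the data, and \<open>nn_integral\<close> would be a lower integral then.
\<close>

definition outer_expectation :: "'b measure \<Rightarrow> ('b \<Rightarrow> ennreal) \<Rightarrow> ennreal" where
  "outer_expectation M F =
     (INF G\<in>{G \<in> borel_measurable M. \<forall>\<omega>\<in>space M. F \<omega> \<le> G \<omega>}. \<integral>\<^sup>+\<omega>. G \<omega> \<partial>M)"

definition sup_risk ::
    "'a measure \<Rightarrow> real \<Rightarrow> nat \<Rightarrow> ((nat \<Rightarrow> 'a \<times> real) \<Rightarrow> 'a \<Rightarrow> real) \<Rightarrow> ('a \<Rightarrow> real) \<Rightarrow> ennreal" where
  "sup_risk \<mu> \<sigma> n fhat f =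
     outer_expectation (sample \<mu> \<sigma> n f) (\<lambda>D. sup_norm (space \<mu>) (\<lambda>x. fhat D x - f x))"

end

theory Submission imports Defs begin

text \<open>
  Le Cam's two point method suffices for the rate: the supremum norm sees a single point, and a
  single spike can be tall there while being small in mean square.

  Fix a point \<open>x0\<close> with \<open>K = (\<Sum>i<m. (e i x0)\<^sup>2) \<ge> m\<close>. Such a point exists because the integral
  of this sum over the probability measure \<open>\<mu>\<close> is \<open>m\<close>. The two hypotheses are \<open>0\<close> and the spike
  \<open>f = (\<Sum>i<m. t * e i x0 * e i)\<close>, a multiple of the reproducing kernel at \<open>x0\<close> of the span of the
  first \<open>m\<close> eigenfunctions. By orthonormality \<open>\<parallel>f\<parallel>\<^sup>2 = t\<^sup>2 * K\<close> in \<open>L\<^sup>2\<close>, while \<open>f x0 = t * K\<close>. Taking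
  \<open>t\<^sup>2 * K = \<tau>\<^sup>2 / n\<close> with \<open>\<tau> \<le> \<sigma>\<close> makes the two laws of the sample overlap by a fixed amount, so every
  estimator errs at \<open>x0\<close> by a multiple of \<open>f x0 = \<tau> * sqrt (K / n) \<ge> \<tau> * sqrt (m / n)\<close> under one of
  them. The lower eigenvalue bound gives \<open>lam i powr (- s) \<le> c powr (- s) * m powr (s * \<beta>)\<close> for
  \<open>i < m\<close>, so the power norm of \<open>f\<close> is at most \<open>R\<close> as long as \<open>m powr (s * \<beta>)\<close> is of order \<open>n\<close> and
  \<open>\<tau>\<close> is small. The choice \<open>m = \<lceil>n powr (1 / (s * \<beta>))\<rceil>\<close> turns \<open>sqrt (m / n)\<close> into the claimed rate.

  The height \<open>f x0\<close> may exceed \<open>\<tau> * sqrt (m / n)\<close> by an uncontrolled factor, since \<open>K\<close> may be much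
  larger than \<open>m\<close>. The overlap of the two laws is therefore measured by the Hellinger affinity
  \<open>\<integral> sqrt (p * q)\<close>, which the mean square of \<open>f\<close> alone controls; a second moment of the
  likelihood ratio would involve \<open>exp (f\<^sup>2 / \<sigma>\<^sup>2)\<close>. The affinity is multiplicative over the
  observations (\<open>sup_risk_two_points\<close>), and it bounds the overlap \<open>\<integral> min p q\<close> from below
  (\<open>nn_integral_min_ge_affinity\<close>).
\<close>

section \<open>Two hypotheses that cannot be told apart\<close>

text \<open>
  With \<open>u\<close> the smaller and \<open>v\<close> the larger of \<open>p\<close> and \<open>q\<close>, the inequality of the geometric and
  arithmetic means gives \<open>sqrt (p * q) = sqrt (u * v) \<le> u + v / 4 \<le> u + (p + q) / 4\<close>, and the last
  term integrates to \<open>1 / 2\<close>. The bound is weaker than the one from the Cauchy--Schwarz inequality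
  but is of use whenever the affinity exceeds \<open>1 / 2\<close>.
\<close>

lemma nn_integral_min_ge_affinity:
  fixes p q :: "'b \<Rightarrow> real"
  assumes [measurable]: "p \<in> borel_measurable M" "q \<in> borel_measurable M"
    and nonneg: "\<And>x. 0 \<le> p x" "\<And>x. 0 \<le> q x"
    and one: "(\<integral>\<^sup>+x. p x \<partial>M) = 1" "(\<integral>\<^sup>+x. q x \<partial>M) = 1"
    and affinity: "ennreal a \<le> (\<integral>\<^sup>+x. sqrt (p x * q x) \<partial>M)"
  shows "ennreal (a - 1 / 2) \<le> (\<integral>\<^sup>+x. min (p x) (q x) \<partial>M)"
proof -
  have pt: "sqrt (p x * q x) \<le> min (p x) (q x) + (p x / 4 + q x / 4)" for x
  proof (rule real_le_lsqrt)
    have "p x * q x = min (p x) (q x) * max (p x) (q x)"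
      by (simp add: min_def max_def)
    also have "\<dots> \<le> (min (p x) (q x) + max (p x) (q x) / 4)\<^sup>2"
      using zero_le_power2[of "min (p x) (q x) - max (p x) (q x) / 4"]
      by (simp add: power2_eq_square algebra_simps)
    also have "\<dots> \<le> (min (p x) (q x) + (p x / 4 + q x / 4))\<^sup>2"
      using nonneg[of x] by (intro power_mono) (auto simp: min_def max_def)
    finally show "p x * q x \<le> (min (p x) (q x) + (p x / 4 + q x / 4))\<^sup>2" .
  qed (use nonneg[of x] in auto)
  have quarter: "(\<integral>\<^sup>+x. r x / 4 \<partial>M) = ennreal (1 / 4)"
    if [measurable]: "r \<in> borel_measurable M" and "\<And>x. 0 \<le> r x" "(\<integral>\<^sup>+x. r x \<partial>M) = 1"
    for r :: "'b \<Rightarrow> real"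
  proof -
    have "(\<integral>\<^sup>+x. r x / 4 \<partial>M) = (\<integral>\<^sup>+x. ennreal (1 / 4) * r x \<partial>M)"
      using that(2) by (intro nn_integral_cong) (simp add: ennreal_mult'[symmetric])
    then show ?thesis
      using that(3) by (simp add: nn_integral_cmult)
  qed
  have "ennreal a \<le> (\<integral>\<^sup>+x. ennreal (min (p x) (q x)) + (ennreal (p x / 4) + ennreal (q x / 4)) \<partial>M)"
  proof (rule order_trans[OF affinity], rule nn_integral_mono)
    fix x
    show "ennreal (sqrt (p x * q x))
        \<le> ennreal (min (p x) (q x)) + (ennreal (p x / 4) + ennreal (q x / 4))"
      using pt[of x] nonneg[of x] by (simp flip: ennreal_plus)
  qed
  also have "\<dots> = (\<integral>\<^sup>+x. min (p x) (q x) \<partial>M) + (ennreal (1 / 4) + ennreal (1 / 4))"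
    using quarter[of p] quarter[of q] nonneg one by (simp add: nn_integral_add)
  finally have le: "ennreal a \<le> (\<integral>\<^sup>+x. min (p x) (q x) \<partial>M) + ennreal (1 / 2)"
    by (simp flip: ennreal_plus)
  show ?thesis
  proof (cases "(\<integral>\<^sup>+x. min (p x) (q x) \<partial>M)")
    case (real r)
    then have "ennreal a \<le> ennreal (r + 1 / 2)"
      using le by (simp add: ennreal_plus)
    then have "a \<le> r + 1 / 2"
      using real by (subst (asm) ennreal_le_iff) auto
    then show ?thesis
      using real by (simp add: ennreal_leI)
  qed simp
qed

text \<open>
  Le Cam's bound. Measurable majorants of the two losses add up to at least \<open>\<Delta>\<close> everywhere, so their
  expectations add up to at least \<open>\<Delta> * (\<integral> min p q)\<close>. Working with majorants is what makes the
  argument valid for losses that are not measurable.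
\<close>

lemma outer_expectation_two_points:
  fixes p q :: "'b \<Rightarrow> real"
  assumes [measurable]: "p \<in> borel_measurable M" "q \<in> borel_measurable M"
    and nonneg: "\<And>x. 0 \<le> p x" "\<And>x. 0 \<le> q x"
    and one: "(\<integral>\<^sup>+x. p x \<partial>M) = 1" "(\<integral>\<^sup>+x. q x \<partial>M) = 1"
    and affinity: "ennreal a \<le> (\<integral>\<^sup>+x. sqrt (p x * q x) \<partial>M)"
    and separation: "\<And>x. x \<in> space M \<Longrightarrow> ennreal \<Delta> \<le> F x + G x"
    and \<Delta>: "0 \<le> \<Delta>" and a: "1 / 2 \<le> a"
  shows "ennreal ((a - 1 / 2) * \<Delta> / 2) \<le>
    max (outer_expectation (density M p) F) (outer_expectation (density M q) G)"
proof (rule ccontr)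
  assume "\<not> ?thesis"
  then have less: "outer_expectation (density M p) F < ennreal ((a - 1 / 2) * \<Delta> / 2)"
      "outer_expectation (density M q) G < ennreal ((a - 1 / 2) * \<Delta> / 2)"
    by (auto simp: not_le)
  then obtain F' G'
    where [measurable]: "F' \<in> borel_measurable M" "G' \<in> borel_measurable M"
      and F': "\<And>x. x \<in> space M \<Longrightarrow> F x \<le> F' x"
      and G': "\<And>x. x \<in> space M \<Longrightarrow> G x \<le> G' x"
      and F'_less: "(\<integral>\<^sup>+x. F' x \<partial>density M p) < ennreal ((a - 1 / 2) * \<Delta> / 2)"
      and G'_less: "(\<integral>\<^sup>+x. G' x \<partial>density M q) < ennreal ((a - 1 / 2) * \<Delta> / 2)"
    unfolding outer_expectation_def INF_less_iff by auto
  have "ennreal ((a - 1 / 2) * \<Delta>) = ennreal \<Delta> * ennreal (a - 1 / 2)"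
    using \<Delta> a by (simp add: ennreal_mult mult.commute)
  also have "\<dots> \<le> ennreal \<Delta> * (\<integral>\<^sup>+x. min (p x) (q x) \<partial>M)"
    by (intro mult_left_mono nn_integral_min_ge_affinity nonneg one affinity) auto
  also have "\<dots> = (\<integral>\<^sup>+x. ennreal \<Delta> * min (p x) (q x) \<partial>M)"
    by (simp add: nn_integral_cmult)
  also have "\<dots> \<le> (\<integral>\<^sup>+x. p x * F' x + q x * G' x \<partial>M)"
  proof (rule nn_integral_mono)
    fix x assume x: "x \<in> space M"
    have "ennreal \<Delta> * min (p x) (q x) \<le> (F' x + G' x) * min (p x) (q x)"
      using separation[OF x] F'[OF x] G'[OF x]
      by (intro mult_right_mono) (auto intro: order_trans add_mono)
    also have "\<dots> = min (p x) (q x) * F' x + min (p x) (q x) * G' x"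
      unfolding distrib_right by (simp add: mult.commute)
    also have "\<dots> \<le> p x * F' x + q x * G' x"
      by (intro add_mono mult_right_mono ennreal_leI) auto
    finally show "ennreal \<Delta> * min (p x) (q x) \<le> p x * F' x + q x * G' x" .
  qed
  also have "\<dots> = (\<integral>\<^sup>+x. F' x \<partial>density M p) + (\<integral>\<^sup>+x. G' x \<partial>density M q)"
    by (simp add: nn_integral_add nn_integral_density)
  also have "\<dots> < ennreal ((a - 1 / 2) * \<Delta> / 2) + ennreal ((a - 1 / 2) * \<Delta> / 2)"
    by (rule add_strict_mono[OF F'_less G'_less])
  also have "\<dots> = ennreal ((a - 1 / 2) * \<Delta>)"
    using \<Delta> a by (simp flip: ennreal_plus)
  finally show False
    by simp
qed

section \<open>The Hellinger affinity of two Gaussian samples\<close>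

text \<open>
  Completing the square: the geometric mean of two Gaussian densities with a common variance is a
  Gaussian density centred between them, up to a factor. That factor is the affinity of the two.
\<close>

lemma sqrt_normal_density_mult:
  assumes "\<sigma> > 0"
  shows "sqrt (normal_density a \<sigma> y * normal_density b \<sigma> y) =
    exp (- ((a - b)\<^sup>2 / (8 * \<sigma>\<^sup>2))) * normal_density ((a + b) / 2) \<sigma> y"
proof (rule real_sqrt_unique)
  have "2 * (- ((a - b)\<^sup>2 / (8 * \<sigma>\<^sup>2)) + - (y - (a + b) / 2)\<^sup>2 / (2 * \<sigma>\<^sup>2)) =
      - (y - a)\<^sup>2 / (2 * \<sigma>\<^sup>2) + - (y - b)\<^sup>2 / (2 * \<sigma>\<^sup>2)"
    using assms by (simp add: field_simps power2_eq_square)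
  then show "(exp (- ((a - b)\<^sup>2 / (8 * \<sigma>\<^sup>2))) * normal_density ((a + b) / 2) \<sigma> y)\<^sup>2 =
      normal_density a \<sigma> y * normal_density b \<sigma> y"
    unfolding normal_density_def
    by (simp add: power_mult_distrib exp_double[symmetric] mult_exp_exp power2_eq_square)
qed simp

lemma nn_integral_normal_density:
  assumes "\<sigma> > 0"
  shows "(\<integral>\<^sup>+y. normal_density a \<sigma> y \<partial>lborel) = 1"
  using prob_space.emeasure_space_1[OF prob_space_normal_density[OF assms, of a]]
  by (simp add: emeasure_density)

text \<open>
  Under this description the laws for different regression functions have densities with respect to
  one measure, as the affinity requires.
\<close>

lemma observation_eq_density:
  assumes "prob_space \<mu>" and \<sigma>: "\<sigma> > 0" and [measurable]: "f \<in> borel_measurable \<mu>"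
  shows "observation \<mu> \<sigma> f =
    density (\<mu> \<Otimes>\<^sub>M lborel) (\<lambda>z. ennreal (normal_density (f (fst z)) \<sigma> (snd z)))"
proof (rule measure_eqI)
  interpret prob_space \<mu> by fact
  interpret G: prob_space "gaussian \<sigma>"
    unfolding gaussian_def using \<sigma> by (rule prob_space_normal_density)
  have [measurable_cong]: "sets (gaussian \<sigma>) = sets borel"
    by (simp add: gaussian_def)
  show "sets (observation \<mu> \<sigma> f) =
      sets (density (\<mu> \<Otimes>\<^sub>M lborel) (\<lambda>z. ennreal (normal_density (f (fst z)) \<sigma> (snd z))))"
    by (simp add: observation_def cong: sets_pair_measure_cong)
  fix A assume "A \<in> sets (observation \<mu> \<sigma> f)"
  then have A: "A \<in> sets (\<mu> \<Otimes>\<^sub>M borel)"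
    by (simp add: observation_def)
  then have [measurable]: "A \<in> sets (\<mu> \<Otimes>\<^sub>M lborel)"
    by (simp cong: sets_pair_measure_cong)
  note A[measurable]
  have "emeasure (observation \<mu> \<sigma> f) A =
      (\<integral>\<^sup>+z. indicator A z \<partial>observation \<mu> \<sigma> f)"
    using A by (simp add: observation_def)
  also have "\<dots> = (\<integral>\<^sup>+z. indicator A (fst z, f (fst z) + snd z) \<partial>(\<mu> \<Otimes>\<^sub>M gaussian \<sigma>))"
    unfolding observation_def by (subst nn_integral_distr) (auto simp: case_prod_beta)
  also have "\<dots> = (\<integral>\<^sup>+x. \<integral>\<^sup>+t. indicator A (x, f x + t) \<partial>gaussian \<sigma> \<partial>\<mu>)"
    by (subst G.nn_integral_fst[symmetric]) auto
  also have "\<dots> = (\<integral>\<^sup>+x. \<integral>\<^sup>+y. ennreal (normal_density (f x) \<sigma> y) * indicator A (x, y) \<partial>lborel \<partial>\<mu>)"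
  proof (rule nn_integral_cong)
    fix x assume [measurable]: "x \<in> space \<mu>"
    have "(\<integral>\<^sup>+t. indicator A (x, f x + t) \<partial>gaussian \<sigma>) =
        (\<integral>\<^sup>+t. ennreal (normal_density 0 \<sigma> t) * indicator A (x, f x + t) \<partial>lborel)"
      unfolding gaussian_def by (subst nn_integral_density) auto
    also have "\<dots> = (\<integral>\<^sup>+y. ennreal (normal_density (f x) \<sigma> y) * indicator A (x, y) \<partial>lborel)"
      by (subst nn_integral_real_affine[where c = 1 and t = "f x"])
        (auto simp: normal_density_def)
    finally show "(\<integral>\<^sup>+t. indicator A (x, f x + t) \<partial>gaussian \<sigma>) =
        (\<integral>\<^sup>+y. ennreal (normal_density (f x) \<sigma> y) * indicator A (x, y) \<partial>lborel)" .
  qed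
  also have "\<dots> = (\<integral>\<^sup>+z. ennreal (normal_density (f (fst z)) \<sigma> (snd z)) * indicator A z
      \<partial>(\<mu> \<Otimes>\<^sub>M lborel))"
    by (subst lborel.nn_integral_fst[symmetric]) (auto simp: normal_density_def)
  also have "\<dots> = emeasure (density (\<mu> \<Otimes>\<^sub>M lborel)
      (\<lambda>z. ennreal (normal_density (f (fst z)) \<sigma> (snd z)))) A"
    by (subst emeasure_density) (auto simp: case_prod_beta normal_density_def)
  finally show "emeasure (observation \<mu> \<sigma> f) A =
      emeasure (density (\<mu> \<Otimes>\<^sub>M lborel) (\<lambda>z. ennreal (normal_density (f (fst z)) \<sigma> (snd z)))) A" .
qed

lemma PiM_density:
  assumes "sigma_finite_measure M" "finite I" and [measurable]: "p \<in> borel_measurable M"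
    and "sigma_finite_measure (density M p)"
  shows "PiM I (\<lambda>_. density M p) = density (PiM I (\<lambda>_. M)) (\<lambda>\<omega>. \<Prod>i\<in>I. p (\<omega> i))"
proof -
  interpret M: product_sigma_finite "\<lambda>_. M"
    by (rule product_sigma_finite.intro) fact
  interpret D: product_sigma_finite "\<lambda>_. density M p"
    by (rule product_sigma_finite.intro) fact
  note [simp] = \<open>finite I\<close>
  have sets: "sets (PiM I (\<lambda>_. M)) = sets (PiM I (\<lambda>_. density M p))"
    by (rule sets_PiM_cong) auto
  show ?thesis
  proof (rule D.PiM_eqI[symmetric])
    fix A :: "'b \<Rightarrow> 'a set" assume "\<And>i. i \<in> I \<Longrightarrow> A i \<in> sets (density M p)"
    then have A[measurable]: "\<And>i. i \<in> I \<Longrightarrow> A i \<in> sets M"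
      by simp
    have box: "indicator (Pi\<^sub>E I A) \<omega> = (\<Prod>i\<in>I. indicator (A i) (\<omega> i) :: ennreal)"
      if "\<omega> \<in> space (PiM I (\<lambda>_. M))" for \<omega>
    proof (cases "\<forall>i\<in>I. \<omega> i \<in> A i")
      case True
      then show ?thesis
        using that by (auto simp: space_PiM indicator_def PiE_def)
    next
      case False
      then have "(\<Prod>i\<in>I. indicator (A i) (\<omega> i) :: ennreal) = 0"
        by (intro prod_zero) (auto simp: indicator_def)
      then show ?thesis
        using False by (auto simp: indicator_def PiE_def)
    qed
    have "emeasure (density (PiM I (\<lambda>_. M)) (\<lambda>\<omega>. \<Prod>i\<in>I. p (\<omega> i))) (Pi\<^sub>E I A) =
        (\<integral>\<^sup>+\<omega>. (\<Prod>i\<in>I. p (\<omega> i)) * indicator (Pi\<^sub>E I A) \<omega> \<partial>PiM I (\<lambda>_. M))"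
      by (subst emeasure_density) (auto intro!: sets_PiM_I_finite)
    also have "\<dots> = (\<integral>\<^sup>+\<omega>. (\<Prod>i\<in>I. p (\<omega> i) * indicator (A i) (\<omega> i)) \<partial>PiM I (\<lambda>_. M))"
      by (intro nn_integral_cong) (simp add: box prod.distrib)
    also have "\<dots> = (\<Prod>i\<in>I. \<integral>\<^sup>+x. p x * indicator (A i) x \<partial>M)"
      by (rule M.product_nn_integral_prod) auto
    also have "\<dots> = (\<Prod>i\<in>I. emeasure (density M p) (A i))"
      by (intro prod.cong) (auto simp: emeasure_density)
    finally show "emeasure (density (PiM I (\<lambda>_. M)) (\<lambda>\<omega>. \<Prod>i\<in>I. p (\<omega> i))) (Pi\<^sub>E I A) =
        (\<Prod>i\<in>I. emeasure (density M p) (A i))" .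
  qed (simp_all add: sets)
qed

text \<open>
  Given the covariate \<open>x\<close>, the affinity is \<open>exp (- (f x - g x)\<^sup>2 / (8 * \<sigma>\<^sup>2))\<close>, and \<open>exp (- r) \<ge> 1 - r\<close>.
\<close>

lemma observation_affinity:
  assumes "prob_space \<mu>" and \<sigma>: "\<sigma> > 0"
    and [measurable]: "f \<in> borel_measurable \<mu>" "g \<in> borel_measurable \<mu>"
    and int: "integrable \<mu> (\<lambda>x. (f x - g x)\<^sup>2)"
  shows "ennreal (1 - (LINT x|\<mu>. (f x - g x)\<^sup>2) / (8 * \<sigma>\<^sup>2)) \<le>
    (\<integral>\<^sup>+z. sqrt (normal_density (f (fst z)) \<sigma> (snd z) * normal_density (g (fst z)) \<sigma> (snd z))
      \<partial>(\<mu> \<Otimes>\<^sub>M lborel))"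
proof -
  interpret prob_space \<mu> by fact
  define E where "E x = exp (- ((f x - g x)\<^sup>2 / (8 * \<sigma>\<^sup>2)))" for x
  have [measurable]: "E \<in> borel_measurable \<mu>"
    unfolding E_def by measurable
  have E_ge: "1 - (f x - g x)\<^sup>2 / (8 * \<sigma>\<^sup>2) \<le> E x" for x
    using exp_ge_add_one_self[of "- ((f x - g x)\<^sup>2 / (8 * \<sigma>\<^sup>2))"] by (simp add: E_def)
  have E: "integrable \<mu> E"
    by (rule integrable_const_bound[of _ 1]) (auto simp: E_def)
  have "1 - (LINT x|\<mu>. (f x - g x)\<^sup>2) / (8 * \<sigma>\<^sup>2) =
      (LINT x|\<mu>. 1 - (f x - g x)\<^sup>2 / (8 * \<sigma>\<^sup>2))"
    using int by (simp add: prob_space)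
  also have "\<dots> \<le> (LINT x|\<mu>. E x)"
    using int E E_ge by (intro integral_mono) auto
  finally have "ennreal (1 - (LINT x|\<mu>. (f x - g x)\<^sup>2) / (8 * \<sigma>\<^sup>2)) \<le> ennreal (LINT x|\<mu>. E x)"
    by (rule ennreal_leI)
  also have "\<dots> = (\<integral>\<^sup>+x. E x \<partial>\<mu>)"
    by (intro nn_integral_eq_integral[symmetric] E) (auto simp: E_def)
  also have "\<dots> = (\<integral>\<^sup>+x. \<integral>\<^sup>+y. sqrt (normal_density (f x) \<sigma> y * normal_density (g x) \<sigma> y)
      \<partial>lborel \<partial>\<mu>)"
    using \<sigma>
    by (intro nn_integral_cong)
      (simp add: sqrt_normal_density_mult ennreal_mult' nn_integral_cmult
        nn_integral_normal_density E_def)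
  also have "\<dots> = (\<integral>\<^sup>+z. sqrt (normal_density (f (fst z)) \<sigma> (snd z) *
      normal_density (g (fst z)) \<sigma> (snd z)) \<partial>(\<mu> \<Otimes>\<^sub>M lborel))"
    by (subst lborel.nn_integral_fst[symmetric]) (auto simp: normal_density_def)
  finally show ?thesis .
qed

text \<open>
  The affinity of \<open>n\<close> observations is the \<open>n\<close>-th power of that of one, hence at least
  \<open>(1 - \<delta>) ^ n \<ge> 1 - n * \<delta> \<ge> 7 / 8\<close> with \<open>\<delta> = \<parallel>f - g\<parallel>\<^sup>2 / (8 * \<sigma>\<^sup>2) \<le> 1 / (8 * n)\<close>. The constant
  \<open>3 / 16\<close> is \<open>(7 / 8 - 1 / 2) / 2\<close>.
\<close>

lemma sup_risk_two_points:
  assumes "prob_space \<mu>" and \<sigma>: "\<sigma> > 0"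
    and [measurable]: "f \<in> borel_measurable \<mu>" "g \<in> borel_measurable \<mu>"
    and int: "integrable \<mu> (\<lambda>x. (f x - g x)\<^sup>2)"
    and close: "real n * (LINT x|\<mu>. (f x - g x)\<^sup>2) \<le> \<sigma>\<^sup>2"
    and x: "x \<in> space \<mu>" and n: "n > 0"
  shows "ennreal (3 / 16 * \<bar>f x - g x\<bar>) \<le>
    max (sup_risk \<mu> \<sigma> n fhat f) (sup_risk \<mu> \<sigma> n fhat g)"
proof -
  interpret prob_space \<mu> by fact
  define M where "M = \<mu> \<Otimes>\<^sub>M (lborel :: real measure)"
  interpret P: pair_sigma_finite \<mu> "lborel :: real measure" ..
  interpret Mn: product_sigma_finite "\<lambda>_. M"
    by (rule product_sigma_finite.intro) (simp add: M_def P.sigma_finite_measure_axioms)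
  define p where "p f z = normal_density (f (fst z)) \<sigma> (snd z)" for f and z :: "'a \<times> real"
  have p_nonneg: "0 \<le> p u z" for u z
    by (simp add: p_def)
  have p_measurable[measurable]: "p u \<in> borel_measurable M"
    if [measurable]: "u \<in> borel_measurable \<mu>" for u
    unfolding p_def M_def normal_density_def by measurable
  have p_one: "(\<integral>\<^sup>+z. p u z \<partial>M) = 1" if [measurable]: "u \<in> borel_measurable \<mu>" for u
    using \<sigma> p_measurable[OF that] unfolding M_def p_def
    by (subst lborel.nn_integral_fst[symmetric])
      (auto simp: nn_integral_normal_density emeasure_space_1)
  define pn where "pn u \<omega> = (\<Prod>i<n. p u (\<omega> i))" for u \<omega>
  have pn_nonneg: "0 \<le> pn u \<omega>" for u \<omega>
    by (simp add: pn_def p_nonneg prod_nonneg)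
  have pn_measurable[measurable]: "pn u \<in> borel_measurable (PiM {..<n} (\<lambda>_. M))"
    if [measurable]: "u \<in> borel_measurable \<mu>" for u
    unfolding pn_def by measurable
  have pn_one: "(\<integral>\<^sup>+\<omega>. pn u \<omega> \<partial>PiM {..<n} (\<lambda>_. M)) = 1"
    if [measurable]: "u \<in> borel_measurable \<mu>" for u
  proof -
    have "(\<integral>\<^sup>+\<omega>. pn u \<omega> \<partial>PiM {..<n} (\<lambda>_. M)) =
        (\<integral>\<^sup>+\<omega>. (\<Prod>i<n. ennreal (p u (\<omega> i))) \<partial>PiM {..<n} (\<lambda>_. M))"
      by (simp add: pn_def prod_ennreal p_nonneg)
    also have "\<dots> = (\<Prod>i<n. \<integral>\<^sup>+z. p u z \<partial>M)"
      by (rule Mn.product_nn_integral_prod) auto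
    finally show ?thesis
      by (simp add: p_one)
  qed
  have sample: "sample \<mu> \<sigma> n u = density (PiM {..<n} (\<lambda>_. M)) (pn u)"
    if [measurable]: "u \<in> borel_measurable \<mu>" for u
  proof -
    have obs: "observation \<mu> \<sigma> u = density M (\<lambda>z. ennreal (p u z))"
      using observation_eq_density[OF \<open>prob_space \<mu>\<close> \<sigma> that]
      by (simp add: M_def p_def)
    have "prob_space (density M (\<lambda>z. ennreal (p u z)))"
      by (rule prob_spaceI) (simp add: emeasure_density p_one cong: nn_integral_cong)
    then have "sigma_finite_measure (density M (\<lambda>z. ennreal (p u z)))"
      by (intro finite_measure.axioms(1) prob_space.finite_measure)
    then have "sample \<mu> \<sigma> n u =
        density (PiM {..<n} (\<lambda>_. M)) (\<lambda>\<omega>. \<Prod>i<n. ennreal (p u (\<omega> i)))"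
      unfolding sample_def obs by (intro PiM_density Mn.sigma_finite_measures) auto
    then show ?thesis
      by (simp add: pn_def prod_ennreal p_nonneg)
  qed
  have sqrt_prod: "(\<Prod>i\<in>I. sqrt (r i)) = sqrt (\<Prod>i\<in>I. r i)" for I :: "nat set" and r
    by (induction I rule: infinite_finite_induct) (auto simp: real_sqrt_mult)
  define \<delta> where "\<delta> = (LINT x|\<mu>. (f x - g x)\<^sup>2) / (8 * \<sigma>\<^sup>2)"
  have \<delta>: "real n * \<delta> \<le> 1 / 8"
    using close \<sigma> by (simp add: \<delta>_def field_simps)
  have "0 \<le> \<delta>"
    by (simp add: \<delta>_def)
  then have "\<delta> \<le> real n * \<delta>"
    using n by (simp add: mult_le_cancel_right1)
  then have \<delta>1: "\<delta> \<le> 1"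
    using \<delta> by simp
  have "7 / 8 \<le> 1 + real n * (- \<delta>)"
    using \<delta> by simp
  also have "\<dots> \<le> (1 - \<delta>) ^ n"
    using Bernoulli_inequality[of "- \<delta>" n] \<delta>1 by simp
  finally have "ennreal (7 / 8) \<le> ennreal ((1 - \<delta>) ^ n)"
    by (rule ennreal_leI)
  also have "\<dots> = ennreal (1 - \<delta>) ^ n"
    using \<delta>1 by (simp add: ennreal_power)
  also have "\<dots> \<le> (\<integral>\<^sup>+z. sqrt (p f z * p g z) \<partial>M) ^ n"
    using observation_affinity[OF \<open>prob_space \<mu>\<close> \<sigma> assms(3,4) int]
    by (intro power_mono) (auto simp: \<delta>_def p_def M_def)
  also have "\<dots> = (\<Prod>i<n. \<integral>\<^sup>+z. sqrt (p f z * p g z) \<partial>M)"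
    by simp
  also have "\<dots> = (\<integral>\<^sup>+\<omega>. (\<Prod>i<n. ennreal (sqrt (p f (\<omega> i) * p g (\<omega> i)))) \<partial>PiM {..<n} (\<lambda>_. M))"
    by (rule Mn.product_nn_integral_prod[symmetric]) auto
  also have "\<dots> = (\<integral>\<^sup>+\<omega>. sqrt (pn f \<omega> * pn g \<omega>) \<partial>PiM {..<n} (\<lambda>_. M))"
    by (simp add: pn_def prod_ennreal p_nonneg sqrt_prod flip: prod.distrib)
  finally have affinity: "ennreal (7 / 8) \<le>
    (\<integral>\<^sup>+\<omega>. sqrt (pn f \<omega> * pn g \<omega>) \<partial>PiM {..<n} (\<lambda>_. M))" .
  have "ennreal ((7 / 8 - 1 / 2) * \<bar>f x - g x\<bar> / 2) \<le>
    max (sup_risk \<mu> \<sigma> n fhat f) (sup_risk \<mu> \<sigma> n fhat g)"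
    unfolding sup_risk_def sample[OF assms(3)] sample[OF assms(4)]
  proof (rule outer_expectation_two_points[OF _ _ _ _ _ _ affinity])
    fix D
    have "ennreal \<bar>f x - g x\<bar> \<le> ennreal \<bar>fhat D x - f x\<bar> + ennreal \<bar>fhat D x - g x\<bar>"
      by (simp flip: ennreal_plus)
    also have "\<dots> \<le> sup_norm (space \<mu>) (\<lambda>x. fhat D x - f x) + sup_norm (space \<mu>) (\<lambda>x. fhat D x - g x)"
      unfolding sup_norm_def using x by (intro add_mono SUP_upper)
    finally show "ennreal \<bar>f x - g x\<bar> \<le>
      sup_norm (space \<mu>) (\<lambda>x. fhat D x - f x) + sup_norm (space \<mu>) (\<lambda>x. fhat D x - g x)" .
  qed (simp_all add: pn_nonneg pn_one)
  then show ?thesis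
    by simp
qed

section \<open>Finite combinations of eigenfunctions\<close>

lemma square_integrable_mult:
  assumes "square_integrable \<mu> f" "square_integrable \<mu> g"
  shows "integrable \<mu> (\<lambda>x. f x * g x)"
proof (rule Bochner_Integration.integrable_bound)
  show "integrable \<mu> (\<lambda>x. (f x)\<^sup>2 + (g x)\<^sup>2)"
    using assms by (simp add: square_integrable_def)
  show "(\<lambda>x. f x * g x) \<in> borel_measurable \<mu>"
    using assms by (auto simp: square_integrable_def)
  have "\<bar>a * b\<bar> \<le> a\<^sup>2 + b\<^sup>2" for a b :: real
    using sum_squares_bound[of "\<bar>a\<bar>" "\<bar>b\<bar>"] mult_nonneg_nonneg[OF abs_ge_zero abs_ge_zero, of a b]
    unfolding abs_mult power2_abs by linarith
  then show "AE x in \<mu>. norm (f x * g x) \<le> norm ((f x)\<^sup>2 + (g x)\<^sup>2)"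
    by (simp add: abs_of_nonneg)
qed

lemma square_integrable_add:
  assumes "square_integrable \<mu> f" "square_integrable \<mu> g"
  shows "square_integrable \<mu> (\<lambda>x. f x + g x)"
  using assms square_integrable_mult[OF assms]
  by (auto simp: square_integrable_def power2_sum mult.assoc)

lemma square_integrable_scale:
  assumes "square_integrable \<mu> f"
  shows "square_integrable \<mu> (\<lambda>x. a * f x)"
  using assms by (auto simp: square_integrable_def power_mult_distrib)

lemma square_integrable_sum:
  assumes "\<And>i. i \<in> I \<Longrightarrow> square_integrable \<mu> (u i)"
  shows "square_integrable \<mu> (\<lambda>x. \<Sum>i\<in>I. u i x)"
  using assms
  by (induction I rule: infinite_finite_induct)
    (auto simp: square_integrable_add, simp_all add: square_integrable_def)

context mercer_kernel
begin

lemma e_square_integrable: "square_integrable \<mu> (e i)"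
  using eigenfunction_basis by (simp add: orthonormal_basis_L2_def)

lemma e_orthonormal: "(LINT x|\<mu>. e i x * e j x) = (if i = j then 1 else 0)"
  using eigenfunction_basis by (simp add: orthonormal_basis_L2_def L2_inner_def)

lemma e_normalised: "(LINT x|\<mu>. (e i x)\<^sup>2) = 1"
  using e_orthonormal[of i i] by (simp add: power2_eq_square)

lemma e_square: "integrable \<mu> (\<lambda>x. (e i x)\<^sup>2)"
  using e_square_integrable by (simp add: square_integrable_def)

lemma combination_square_integrable: "square_integrable \<mu> (\<lambda>x. \<Sum>i<m. b i * e i x)"
  by (intro square_integrable_sum square_integrable_scale e_square_integrable)

lemma combination_inner:
  "L2_inner \<mu> (\<lambda>x. \<Sum>i<m. b i * e i x) (e j) = (if j < m then b j else 0)"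
proof -
  have "L2_inner \<mu> (\<lambda>x. \<Sum>i<m. b i * e i x) (e j) = (LINT x|\<mu>. (\<Sum>i<m. b i * (e i x * e j x)))"
    by (simp add: L2_inner_def sum_distrib_right mult.assoc)
  also have "\<dots> = (\<Sum>i<m. b i * (if i = j then 1 else 0))"
    by (simp add: Bochner_Integration.integral_sum square_integrable_mult e_square_integrable
        e_orthonormal)
  also have "\<dots> = (\<Sum>i<m. if i = j then b i else 0)"
    by (intro sum.cong) auto
  finally show ?thesis
    by simp
qed

lemma combination_norm: "(LINT x|\<mu>. (\<Sum>i<m. b i * e i x)\<^sup>2) = (\<Sum>i<m. (b i)\<^sup>2)"
proof -
  have "S\<^sup>2 = (\<Sum>j<m. b j * (S * e j x))" if "S = (\<Sum>i<m. b i * e i x)" for S x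
    unfolding power2_eq_square by (subst (2) that) (simp add: sum_distrib_left mult.left_commute)
  then have "(LINT x|\<mu>. (\<Sum>i<m. b i * e i x)\<^sup>2) =
      (LINT x|\<mu>. (\<Sum>j<m. b j * ((\<Sum>i<m. b i * e i x) * e j x)))"
    by simp
  also have "\<dots> = (\<Sum>j<m. b j * L2_inner \<mu> (\<lambda>x. \<Sum>i<m. b i * e i x) (e j))"
    using square_integrable_mult[OF combination_square_integrable e_square_integrable]
    by (simp add: Bochner_Integration.integral_sum L2_inner_def)
  finally show ?thesis
    by (simp add: combination_inner power2_eq_square)
qed

text \<open>
  The coefficient of the remainder after \<open>N > j\<close> terms along \<open>e j\<close> is \<open>d\<close>, the difference of the two
  sides. By Bessel's inequality its square is at most the squared norm of the remainder, which tends
  to \<open>0\<close>. This uniqueness of coefficients is what evaluates the definite description behind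
  \<open>power_norm\<close>.
\<close>

lemma L2_sums_coefficient:
  assumes "L2_sums \<mu> (\<lambda>i x. b i * e i x) g"
  shows "L2_inner \<mu> g (e j) = b j"
proof -
  define d where "d = L2_inner \<mu> g (e j) - b j"
  have g: "square_integrable \<mu> g"
    and lim: "(\<lambda>N. LINT x|\<mu>. (g x - (\<Sum>i<N. b i * e i x))\<^sup>2) \<longlonglongrightarrow> 0"
    using assms by (auto simp: L2_sums_def)
  have bessel: "d\<^sup>2 \<le> (LINT x|\<mu>. (g x - (\<Sum>i<N. b i * e i x))\<^sup>2)" if "Suc j \<le> N" for N
  proof -
    define r where "r x = g x - (\<Sum>i<N. b i * e i x)" for x
    have r: "square_integrable \<mu> r"
      using square_integrable_add[OF g square_integrable_scale[OF combination_square_integrable, of "- 1"]]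
      by (simp add: r_def[abs_def])
    have "(LINT x|\<mu>. r x * e j x) =
        L2_inner \<mu> g (e j) - L2_inner \<mu> (\<lambda>x. \<Sum>i<N. b i * e i x) (e j)"
      unfolding r_def L2_inner_def left_diff_distrib
      by (intro Bochner_Integration.integral_diff square_integrable_mult g e_square_integrable
          combination_square_integrable)
    then have inner: "(LINT x|\<mu>. r x * e j x) = d"
      using that by (simp add: combination_inner d_def)
    have "0 \<le> (LINT x|\<mu>. (r x - d * e j x)\<^sup>2)"
      by simp
    also have "\<dots> = (LINT x|\<mu>. (r x)\<^sup>2 - 2 * d * (r x * e j x) + d\<^sup>2 * (e j x * e j x))"
      by (simp add: power2_eq_square algebra_simps)
    also have "\<dots> = (LINT x|\<mu>. (r x)\<^sup>2) - 2 * d * d + d\<^sup>2"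
      using r square_integrable_mult[OF r e_square_integrable[of j]]
        square_integrable_mult[OF e_square_integrable[of j] e_square_integrable[of j]]
      by (simp add: inner e_orthonormal square_integrable_def)
    finally show ?thesis
      by (simp add: power2_eq_square r_def)
  qed
  have "d\<^sup>2 \<le> 0"
    using bessel by (intro LIMSEQ_le_const[OF lim]) auto
  then show ?thesis
    by (simp add: d_def)
qed

lemma combination_power_expansion:
  "power_expansion \<mu> lam e s (\<lambda>i. if i < m then b i * lam i powr (- s / 2) else 0)
     (\<lambda>x. \<Sum>i<m. b i * e i x)"
proof -
  have summand: "(if i < m then b i * lam i powr (- s / 2) else 0) * lam i powr (s / 2) * e i x =
      (if i < m then b i * e i x else 0)" for i x
    using lam_pos[of i] by (simp add: powr_minus)
  \<comment> \<open>From \<open>m\<close> on, the partial sums equal the combination, so the remainder is eventually zero.\<close>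
  have partial: "(\<Sum>i<N. if i < m then b i * e i x else 0) = (\<Sum>i<m. b i * e i x)"
    if "m \<le> N" for N x
  proof -
    have "{..<N} \<inter> {i. i < m} = {..<m}"
      using that by auto
    then show ?thesis
      by (simp add: sum.If_cases)
  qed
  have "\<forall>\<^sub>F N in sequentially. 0 = (LINT x|\<mu>. ((\<Sum>i<m. b i * e i x) -
      (\<Sum>i<N. if i < m then b i * e i x else 0))\<^sup>2)"
    by (rule eventually_mono[OF eventually_ge_at_top[of m]]) (simp add: partial)
  then show ?thesis
    unfolding power_expansion_def L2_sums_def summand
    by (auto intro!: combination_square_integrable summable_finite[of "{..<m}"]
        split: if_splits
        intro: Lim_transform_eventually[OF tendsto_const])
qed

lemma combination_power_norm:
  "power_norm \<mu> lam e s (\<lambda>x. \<Sum>i<m. b i * e i x) = sqrt (\<Sum>i<m. (b i)\<^sup>2 * lam i powr (- s))"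
proof -
  define a where "a i = (if i < m then b i * lam i powr (- s / 2) else 0)" for i
  have a: "power_expansion \<mu> lam e s a (\<lambda>x. \<Sum>i<m. b i * e i x)"
    unfolding a_def[abs_def] by (rule combination_power_expansion)
  have unique: "a' = a" if "power_expansion \<mu> lam e s a' (\<lambda>x. \<Sum>i<m. b i * e i x)" for a'
  proof
    fix i
    have "L2_inner \<mu> (\<lambda>x. \<Sum>i<m. b i * e i x) (e i) = c i * lam i powr (s / 2)"
      if "power_expansion \<mu> lam e s c (\<lambda>x. \<Sum>i<m. b i * e i x)" for c
      using that by (intro L2_sums_coefficient) (simp add: power_expansion_def)
    from this[OF a] this[OF that] have "a' i * lam i powr (s / 2) = a i * lam i powr (s / 2)"
      by simp
    then show "a' i = a i"
      using less_imp_neq[OF lam_pos[of i]] by simp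
  qed
  have square: "(a i)\<^sup>2 = (if i < m then (b i)\<^sup>2 * lam i powr (- s) else 0)" for i
    using lam_pos[of i]
    by (simp add: a_def power_mult_distrib power2_eq_square flip: powr_add)
  have "(\<Sum>i. (a i)\<^sup>2) = (\<Sum>i<m. (a i)\<^sup>2)"
    by (rule suminf_finite) (auto simp: a_def)
  then have sum: "(\<Sum>i. (a i)\<^sup>2) = (\<Sum>i<m. (b i)\<^sup>2 * lam i powr (- s))"
    by (simp add: square)
  show ?thesis
    unfolding power_norm_def
  proof (rule the_equality)
    show "\<exists>a. power_expansion \<mu> lam e s a (\<lambda>x. \<Sum>i<m. b i * e i x) \<and>
        sqrt (\<Sum>i<m. (b i)\<^sup>2 * lam i powr (- s)) = sqrt (\<Sum>i. (a i)\<^sup>2)"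
      using a sum by auto
  qed (use unique sum in auto)
qed

lemma combination_in_power_ball:
  assumes "(\<Sum>i<m. (b i)\<^sup>2 * lam i powr (- s)) \<le> R\<^sup>2" "0 \<le> R"
  shows "(\<lambda>x. \<Sum>i<m. b i * e i x) \<in> power_ball \<mu> lam e s R"
proof -
  have "(\<lambda>i. L2_inner \<mu> (\<lambda>x. \<Sum>i<m. b i * e i x) (e i) * e i x) sums (\<Sum>i<m. b i * e i x)" for x
    using sums_If_finite_set[of "{..<m}" "\<lambda>i. b i * e i x"]
    by (simp add: combination_inner if_distrib[of "\<lambda>c. c * e _ x"] cong: if_cong)
  moreover have "power_norm \<mu> lam e s (\<lambda>x. \<Sum>i<m. b i * e i x) \<le> R"
    using assms by (simp add: combination_power_norm real_le_lsqrt sum_nonneg)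
  ultimately show ?thesis
    using combination_power_expansion[of s m b]
    by (auto simp: power_ball_def power_space_def continuous_version_def)
qed

section \<open>The spike\<close>

text \<open>
  Otherwise the sum would be below \<open>m\<close> everywhere, whereas its mean is \<open>m\<close>.
\<close>

lemma exists_large_christoffel_sum: "\<exists>x\<in>space \<mu>. real m \<le> (\<Sum>i<m. (e i x)\<^sup>2)"
proof (rule ccontr)
  assume "\<not> ?thesis"
  then have less: "\<And>x. x \<in> space \<mu> \<Longrightarrow> (\<Sum>i<m. (e i x)\<^sup>2) < real m"
    by (auto simp: not_le)
  have "(LINT x|\<mu>. (\<Sum>i<m. (e i x)\<^sup>2)) = real m"
    by (simp add: Bochner_Integration.integral_sum e_square e_normalised)
  moreover have "(LINT x|\<mu>. (\<Sum>i<m. (e i x)\<^sup>2)) < real m"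
    using less e_square by (intro expectation_less) auto
  ultimately show False
    by simp
qed

text \<open>
  The trace of the integral operator is at most the supremum of the kernel on the diagonal: Mercer's
  series at \<open>(x, x)\<close> has nonnegative terms, and each term integrates to an eigenvalue.
\<close>

lemma sum_lam_le: "(\<Sum>i<N. lam i) \<le> \<kappa>\<^sup>2"
proof -
  have le: "(\<Sum>i<N. lam i * (e i x)\<^sup>2) \<le> \<kappa>\<^sup>2" if x: "x \<in> space \<mu>" for x
  proof -
    have "(\<lambda>N. \<Sum>i<N. lam i * e i x * e i x) \<longlonglongrightarrow> k x x"
      using tendsto_uniform_limitI[OF mercer_uniform, of "(x, x)"] x by simp
    moreover have "incseq (\<lambda>N. \<Sum>i<N. lam i * e i x * e i x)"
      by (rule incseq_SucI) (simp add: mult.assoc less_imp_le[OF lam_pos])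
    ultimately have "(\<Sum>i<N. lam i * e i x * e i x) \<le> k x x"
      by (rule incseq_le[rotated])
    then show ?thesis
      using kernel_bound[OF x] by (simp add: power2_eq_square mult.assoc)
  qed
  have "(\<Sum>i<N. lam i) = (LINT x|\<mu>. (\<Sum>i<N. lam i * (e i x)\<^sup>2))"
    by (simp add: Bochner_Integration.integral_sum e_square e_normalised)
  also have "\<dots> \<le> \<kappa>\<^sup>2"
    using le e_square by (intro integral_le_const) auto
  finally show ?thesis .
qed

text \<open>
  Since \<open>lam\<close> is summable by \<open>sum_lam_le\<close>, it cannot stay above \<open>c\<close>, as it would for \<open>\<beta> \<le> 0\<close>. The
  sign matters because otherwise \<open>s > 1 / \<beta>\<close> would say nothing about the sign of \<open>s\<close>.
\<close>

lemma decay_exponent_pos: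
  assumes decay: "eigenvalue_decay lam \<beta> c C0" and c: "c > 0"
  shows "\<beta> > 0"
proof (rule ccontr)
  assume "\<not> \<beta> > 0"
  have "c \<le> lam i" for i
  proof -
    have "c * 1 \<le> c * real (Suc i) powr (- \<beta>)"
      using c \<open>\<not> \<beta> > 0\<close> by (intro mult_left_mono ge_one_powr_ge_zero) auto
    also have "\<dots> \<le> lam i"
      using decay by (simp add: eigenvalue_decay_def)
    finally show ?thesis
      by simp
  qed
  then have "real N * c \<le> \<kappa>\<^sup>2" for N
    using sum_bounded_below[of "{..<N}" c lam] sum_lam_le[of N] by simp
  moreover obtain N where "\<kappa>\<^sup>2 / c < real N"
    using reals_Archimedean2 by blast
  ultimately show False
    using c by (auto simp: field_simps not_le dest: order_less_le_trans)
qed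

text \<open>
  The bound for a given estimator, with the explicit constant. The minimum in it is the largest \<open>\<tau>\<close>
  that meets both demands on the spike: \<open>\<tau> \<le> \<sigma>\<close> keeps the two samples indistinguishable, and
  \<open>\<tau>\<^sup>2 * c powr (- s) * 2 powr (s * \<beta>) \<le> R\<^sup>2\<close> keeps the spike in the ball. The factor \<open>2 powr (s * \<beta>)\<close>
  pays for rounding \<open>m\<close> up to an integer: \<open>m \<le> 2 * n powr (1 / (s * \<beta>))\<close>.
\<close>

lemma minimax_lower_bound:
  assumes pos: "\<sigma> > 0" "R > 0" "c > 0" "s > 0"
    and decay: "eigenvalue_decay lam \<beta> c C0" and n: "n > 0"
  shows "ennreal (3 / 16 * min \<sigma> (R * c powr (s / 2) * 2 powr (- (s * \<beta> / 2))) *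
      real n powr (- ((s * \<beta> - 1) / (2 * s * \<beta>)))) \<le>
    (SUP f\<in>power_ball \<mu> lam e s R. sup_risk \<mu> \<sigma> n fhat f)"
proof -
  have "\<beta> > 0"
    using decay_exponent_pos[OF decay] pos by blast
  define q where "q = s * \<beta>"
  have q: "q > 0"
    using \<open>\<beta> > 0\<close> pos by (simp add: q_def)
  define \<tau> where "\<tau> = min \<sigma> (R * c powr (s / 2) * 2 powr (- (q / 2)))"
  have \<tau>: "\<tau> > 0"
    using pos by (simp add: \<tau>_def)
  have \<tau>_\<sigma>: "\<tau>\<^sup>2 \<le> \<sigma>\<^sup>2"
    using \<tau> by (intro power_mono) (auto simp: \<tau>_def)
  have "\<tau>\<^sup>2 \<le> (R * c powr (s / 2) * 2 powr (- (q / 2)))\<^sup>2"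
    using \<tau> by (intro power_mono) (auto simp: \<tau>_def)
  also have "\<dots> = R\<^sup>2 * c powr s * 2 powr (- q)"
    using powr_add[of c "s / 2" "s / 2"] powr_add[of 2 "- (q / 2)" "- (q / 2)"]
    by (simp add: power_mult_distrib power2_eq_square)
  finally have "\<tau>\<^sup>2 * (c powr (- s) * 2 powr q) \<le>
      R\<^sup>2 * c powr s * 2 powr (- q) * (c powr (- s) * 2 powr q)"
    by (intro mult_right_mono) auto
  also have "\<dots> = R\<^sup>2"
    using pos by (simp add: powr_minus field_simps)
  finally have \<tau>_R: "\<tau>\<^sup>2 * (c powr (- s) * 2 powr q) \<le> R\<^sup>2" .

  define u where "u = real n powr (1 / q)"
  define m where "m = nat \<lceil>u\<rceil>"
  have u: "1 \<le> u"
    using n q by (simp add: u_def ge_one_powr_ge_zero)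
  have m: "u \<le> real m" "real m \<le> 2 * u"
    using u by (auto simp: m_def) linarith+
  then have m_pos: "0 < real m"
    using u by linarith
  have "real m powr q \<le> (2 * u) powr q"
    using m q by (intro powr_mono2) auto
  also have "\<dots> = 2 powr q * real n"
    using q n by (simp add: u_def powr_mult powr_powr)
  finally have m_powr: "real m powr q \<le> 2 powr q * real n" .
  have lam_powr: "lam i powr (- s) \<le> c powr (- s) * (2 powr q * real n)" if "i < m" for i
  proof -
    have "real m powr (- \<beta>) \<le> real (Suc i) powr (- \<beta>)"
      using that \<open>\<beta> > 0\<close> by (intro powr_mono2') auto
    then have "c * real m powr (- \<beta>) \<le> c * real (Suc i) powr (- \<beta>)"
      using pos by simp
    also have "\<dots> \<le> lam i"
      using decay by (simp add: eigenvalue_decay_def)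
    finally have "lam i powr (- s) \<le> (c * real m powr (- \<beta>)) powr (- s)"
      using pos m_pos by (intro powr_mono2') auto
    also have "\<dots> = c powr (- s) * real m powr q"
      using pos m_pos by (simp add: powr_mult powr_powr q_def mult.commute)
    finally show ?thesis
      using m_powr by (elim order_trans) (simp add: mult_left_mono)
  qed

  obtain x0 where x0: "x0 \<in> space \<mu>" and large: "real m \<le> (\<Sum>i<m. (e i x0)\<^sup>2)"
    using exists_large_christoffel_sum by blast
  define K where "K = (\<Sum>i<m. (e i x0)\<^sup>2)"
  have K: "real m \<le> K" "0 < K"
    using large m_pos by (auto simp: K_def)
  define t where "t = \<tau> / sqrt (real n * K)"
  have t: "t\<^sup>2 * K = \<tau>\<^sup>2 / real n"
    using K n by (simp add: t_def power_divide)
  define f where "f x = (\<Sum>i<m. t * e i x0 * e i x)" for x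

  have "(\<Sum>i<m. (t * e i x0)\<^sup>2 * lam i powr (- s)) \<le>
      (\<Sum>i<m. (t * e i x0)\<^sup>2 * (c powr (- s) * (2 powr q * real n)))"
    by (intro sum_mono mult_left_mono lam_powr) auto
  also have "\<dots> = t\<^sup>2 * K * (c powr (- s) * (2 powr q * real n))"
    by (simp add: K_def power_mult_distrib sum_distrib_left sum_distrib_right)
  also have "\<dots> = \<tau>\<^sup>2 * (c powr (- s) * 2 powr q)"
    using n by (simp add: t)
  also have "\<dots> \<le> R\<^sup>2"
    by (rule \<tau>_R)
  finally have f_ball: "f \<in> power_ball \<mu> lam e s R"
    unfolding f_def[abs_def] using pos by (intro combination_in_power_ball) auto
  have zero_ball: "(\<lambda>x. 0) \<in> power_ball \<mu> lam e s R"
    using combination_in_power_ball[where b = "\<lambda>_. 0" and m = 0 and s = s and R = R] pos by simp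

  have f: "square_integrable \<mu> f"
    unfolding f_def[abs_def] by (rule combination_square_integrable)
  have "(LINT x|\<mu>. (f x)\<^sup>2) = t\<^sup>2 * K"
    by (simp add: f_def combination_norm power_mult_distrib sum_distrib_left K_def)
  then have close: "real n * (LINT x|\<mu>. (f x - 0)\<^sup>2) \<le> \<sigma>\<^sup>2"
    using n \<tau>_\<sigma> by (simp add: t)

  have "f x0 = t * K"
    by (simp add: f_def K_def sum_distrib_left power2_eq_square mult.assoc)
  also have "\<dots> = \<tau> * sqrt (K / real n)"
    using K n by (simp add: t_def real_sqrt_mult real_sqrt_divide field_simps)
  finally have f_x0: "f x0 = \<tau> * sqrt (K / real n)" .
  have "- ((q - 1) / (2 * q)) = (1 / q - 1) * (1 / 2)"
    using q by (simp add: field_simps)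
  then have "real n powr (- ((q - 1) / (2 * q))) = (real n powr (1 / q - 1)) powr (1 / 2)"
    by (simp only: powr_powr)
  also have "\<dots> = sqrt (u / real n)"
    using n by (simp add: powr_diff u_def powr_half_sqrt)
  also have "\<dots> \<le> sqrt (K / real n)"
    using m K by (intro real_sqrt_le_mono divide_right_mono) auto
  finally have "\<tau> * real n powr (- ((q - 1) / (2 * q))) \<le> \<bar>f x0 - 0\<bar>"
    using \<tau> K by (simp add: f_x0 abs_mult)
  then have "ennreal (3 / 16 * \<tau> * real n powr (- ((q - 1) / (2 * q)))) \<le>
      ennreal (3 / 16 * \<bar>f x0 - 0\<bar>)"
    by (intro ennreal_leI) simp
  also have "\<dots> \<le> max (sup_risk \<mu> \<sigma> n fhat f) (sup_risk \<mu> \<sigma> n fhat (\<lambda>x. 0))"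
    using f close x0 n pos
    by (intro sup_risk_two_points prob_space_axioms) (auto simp: square_integrable_def)
  also have "\<dots> \<le> (SUP f\<in>power_ball \<mu> lam e s R. sup_risk \<mu> \<sigma> n fhat f)"
    using f_ball zero_ball by (intro max.boundedI SUP_upper)
  finally show ?thesis
    by (simp add: \<tau>_def q_def mult.assoc)
qed

end

theorem theorem7:
  fixes \<sigma> \<beta> Lk h s R L c :: real
  assumes "\<sigma> > 0" and "Lk > 0" and "0 < h" and "h \<le> 1 / 2" and "R > 0" and "c > 0"
    and "noise_moment_bound \<sigma> L"
  shows "\<exists>C>0. \<forall>(\<mu> :: (real ^ 'd) measure) k \<kappa> lam e C0 (n :: nat).
     mercer_kernel \<mu> k \<kappa> lam e \<and> radon_measure \<mu> \<and>
     C0 > 0 \<and> eigenvalue_decay lam \<beta> c C0 \<and>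
     holder_kernel (space \<mu>) k Lk h \<and>
     embedding_index \<mu> lam e \<beta> = 1 / \<beta> \<and>
     s > embedding_index \<mu> lam e \<beta> \<and>
     n \<ge> 1 \<longrightarrow>
     ennreal (C * real n powr (- ((s * \<beta> - 1) / (2 * s * \<beta>)))) \<le>
       (INF fhat. SUP f\<in>power_ball \<mu> lam e s R. sup_risk \<mu> \<sigma> n fhat f)"
proof (intro exI conjI allI impI)
  define C where "C = 3 / 16 * min \<sigma> (R * c powr (s / 2) * 2 powr (- (s * \<beta> / 2)))"
  show "C > 0"
    using assms by (simp add: C_def)
  fix \<mu> :: "(real ^ 'd) measure" and k \<kappa> lam e C0 and n :: nat
  assume H: "mercer_kernel \<mu> k \<kappa> lam e \<and> radon_measure \<mu> \<and>
     C0 > 0 \<and> eigenvalue_decay lam \<beta> c C0 \<and>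
     holder_kernel (space \<mu>) k Lk h \<and>
     embedding_index \<mu> lam e \<beta> = 1 / \<beta> \<and>
     s > embedding_index \<mu> lam e \<beta> \<and>
     n \<ge> 1"
  then interpret mercer_kernel \<mu> k \<kappa> lam e
    by blast
  have "\<beta> > 0"
    using decay_exponent_pos H assms by blast
  then have "s > 0"
    using H by (auto intro: less_trans[of 0 "1 / \<beta>"])
  then show "ennreal (C * real n powr (- ((s * \<beta> - 1) / (2 * s * \<beta>)))) \<le>
      (INF fhat. SUP f\<in>power_ball \<mu> lam e s R. sup_risk \<mu> \<sigma> n fhat f)"
    unfolding C_def using H assms by (intro INF_greatest minimax_lower_bound) auto
qed

end
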